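(* Let $m\le n$, let $A\in\mathbb{R}^{n\times n}$ be symmetric positive definite and let $B,C\in\mathbb{R}^{m\times n}$ satisfy $\operatorname{rank}(B)=\operatorname{rank}(C)=m$. Let $\alpha>0$ and suppose that at least one of the following holds: (i) every $x\in\mathcal{S}_\alpha$ satisfies $s(x)>0$ and $|t(x)|<a(x)\sqrt{s(x)}$, where $a(x)=x^*Ax$, $s(x)=\Re(x^*B^TCx)$ and $t(x)=\Im(x^*B^TCx)$; (ii) $C=kB$ for some real $k>0$. Then the preconditioned matrix $P_{SS}^{-1}\mathcal{A}$ is positive stable, and every eigenvalue $\lambda$ of $P_{SS}^{-1}\mathcal{A}$ satisfies $|\lambda|<1$.
   Context: $x^*$ denotes the conjugate transpose and $[x;y]=[x^T,y^T]^T$. A square matrix is positive stable if all its eigenvalues have positive real part. The saddle point matrix is $$\mathcal{A}=\begin{bmatrix}A&B^T\\-C&0\end{bmatrix}\in\mathbb{R}^{(n+m)\times(n+m)},$$ the shift-splitting preconditioner is $$P_{SS}=\alpha I+\mathcal{A}=\begin{bmatrix}\alpha I+A&B^T\\-C&\alpha I\end{bmatrix}$$ (nonsingular under the stated assumptions), and $M_\alpha=(\alpha I+\mathcal{A})^{-1}(\alpha I-\mathcal{A})$. The set $\mathcal{S}_\alpha$ consists of all $x\in\mathbb{C}^n$ with $\|x\|_2=1$ for which there is $y\in\mathbb{C}^m$ such that $[x;y]$ is an eigenvector of $M_\alpha$. *)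

theory Defs
  imports
    "HOL-Analysis.L2_Norm"
    "Jordan_Normal_Form.DL_Rank"
    "Jordan_Normal_Form.Char_Poly"
    "Jordan_Normal_Form.Gauss_Jordan_Elimination"
begin

definition symmetric_pos_def :: "real mat \<Rightarrow> bool" where
  "symmetric_pos_def A \<longleftrightarrow>
     square_mat A \<and> transpose_mat A = A \<and>
     (\<forall>x \<in> carrier_vec (dim_row A). x \<noteq> 0\<^sub>v (dim_row A) \<longrightarrow> x \<bullet> (A *\<^sub>v x) > 0)"

definition positive_stable :: "complex mat \<Rightarrow> bool" where
  "positive_stable A \<longleftrightarrow> square_mat A \<and> (\<forall>\<mu>. eigenvalue A \<mu> \<longrightarrow> Re \<mu> > 0)"

(* Real matrices are regarded as complex ones when eigenvalues or complex vectors are involved. *)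
abbreviation cmat :: "real mat \<Rightarrow> complex mat" where
  "cmat \<equiv> map_mat complex_of_real"

(* Unspecified when the matrix is singular. *)
definition mat_inv :: "real mat \<Rightarrow> real mat" where
  "mat_inv A = the (mat_inverse A)"

definition vec_norm2 :: "complex vec \<Rightarrow> real" where
  "vec_norm2 x = L2_set (\<lambda>i. cmod (x $ i)) {..<dim_vec x}"

(* x^* Q x *)
definition qform :: "complex mat \<Rightarrow> complex vec \<Rightarrow> complex" where
  "qform Q x = conjugate x \<bullet> (Q *\<^sub>v x)"

definition saddle_mat :: "real mat \<Rightarrow> real mat \<Rightarrow> real mat \<Rightarrow> real mat" where
  "saddle_mat A B C = four_block_mat A (transpose_mat B) (- C) (0\<^sub>m (dim_row C) (dim_row B))"

definition P_SS :: "real \<Rightarrow> real mat \<Rightarrow> real mat \<Rightarrow> real mat \<Rightarrow> real mat" where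
  "P_SS \<alpha> A B C = \<alpha> \<cdot>\<^sub>m 1\<^sub>m (dim_row A + dim_row C) + saddle_mat A B C"

definition M_SS :: "real \<Rightarrow> real mat \<Rightarrow> real mat \<Rightarrow> real mat \<Rightarrow> real mat" where
  "M_SS \<alpha> A B C =
     mat_inv (P_SS \<alpha> A B C) * (\<alpha> \<cdot>\<^sub>m 1\<^sub>m (dim_row A + dim_row C) - saddle_mat A B C)"

definition S_set :: "real \<Rightarrow> real mat \<Rightarrow> real mat \<Rightarrow> real mat \<Rightarrow> complex vec set" where
  "S_set \<alpha> A B C =
     {x \<in> carrier_vec (dim_row A). vec_norm2 x = 1 \<and>
        (\<exists>y \<in> carrier_vec (dim_row C). \<exists>\<theta>. eigenvector (cmat (M_SS \<alpha> A B C)) (x @\<^sub>v y) \<theta>)}"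

(* x^* A x is real for the symmetric matrices A it is used with. *)
definition a_form :: "real mat \<Rightarrow> complex vec \<Rightarrow> real" where
  "a_form A x = Re (qform (cmat A) x)"

definition s_form :: "real mat \<Rightarrow> real mat \<Rightarrow> complex vec \<Rightarrow> real" where
  "s_form B C x = Re (qform (cmat (transpose_mat B * C)) x)"

definition t_form :: "real mat \<Rightarrow> real mat \<Rightarrow> complex vec \<Rightarrow> real" where
  "t_form B C x = Im (qform (cmat (transpose_mat B * C)) x)"

end

theory Submission
  imports Defs
begin

text \<open>An eigenvalue \<open>\<mu>\<close> of the preconditioned matrix differs from \<open>1\<close> and has the form
  \<open>\<nu> / (\<alpha> + \<nu>)\<close> for an eigenvalue \<open>\<nu>\<close> of the saddle point matrix, and \<open>Re \<nu> > 0\<close> yields both claims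
  about \<open>\<mu>\<close>. Multiplying the first block row of the eigenvalue equation by \<open>\<nu> x\<^sup>*\<close> and eliminating
  \<open>y\<close> by the second one gives \<open>\<nu>\<^sup>2 - a(x) \<nu> + (s(x) + \<i> t(x)) = 0\<close> for a unit vector \<open>x\<close>, and
  the bounds on \<open>s\<close> and \<open>t\<close> force the nonzero roots of this quadratic into the open right half plane.
  In case (ii), \<open>t(x) = 0 \<le> s(x)\<close> automatically, and the preconditioner is nonsingular because the
  negative number \<open>-\<alpha>\<close> is not an eigenvalue of the saddle point matrix.\<close>

section \<open>Scalar estimates for the eigenvalues\<close>

text \<open>Suppose u \<le> 0. The real part of the equation reads
  \<open>v\<^sup>2 = u\<^sup>2 - a * u + s\<close>, which is at least s, while the imaginary part
  gives |v| a \<le> |v| (a - 2u) = |t|, so |t| < a sqrt s would force \<open>v\<^sup>2 < s\<close>.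
  The second alternative in \<open>st\<close> serves the case C = kB, where s may vanish: there v =
  0 and \<open>u\<^sup>2 = a * u - s\<close> is at most 0, so \<nu> = 0.\<close>

lemma complex_quadratic_root_Re_pos:
  fixes \<nu> :: complex and a s t :: real
  assumes root: "\<nu>\<^sup>2 - a * \<nu> + Complex s t = 0" and "\<nu> \<noteq> 0" and a: "a > 0"
    and st: "s > 0 \<and> \<bar>t\<bar> < a * sqrt s \<or> s \<ge> 0 \<and> t = 0"
  shows "Re \<nu> > 0"
proof (rule ccontr)
  define u v where "u = Re \<nu>" and "v = Im \<nu>"
  assume "\<not> ?thesis"
  then have u: "u \<le> 0" by (simp add: u_def)
  have re: "u\<^sup>2 - v\<^sup>2 - a * u + s = 0" and im: "v * (a - 2 * u) = t"
    using arg_cong[OF root, of Re] arg_cong[OF root, of Im]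
    by (simp_all add: u_def v_def power2_eq_square algebra_simps)
  have au: "a * u \<le> 0" using a u by (simp add: mult_le_0_iff)
  have d: "0 < a" "a \<le> a - 2 * u" using a u by auto
  from st show False
  proof
    assume st: "s > 0 \<and> \<bar>t\<bar> < a * sqrt s"
    have "\<bar>v\<bar> * a \<le> \<bar>v\<bar> * (a - 2 * u)" using d by (intro mult_left_mono) auto
    also have "\<dots> = \<bar>t\<bar>" using im d by (simp add: abs_mult flip: im)
    also have "\<dots> < sqrt s * a" using st by (simp add: mult.commute)
    finally have "\<bar>v\<bar> < sqrt s" using a by simp
    then have "v\<^sup>2 < s" using st real_less_rsqrt real_sqrt_less_iff by (metis real_sqrt_abs)
    moreover have "u\<^sup>2 \<ge> 0" by simp
    ultimately show False using re au by linarith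
  next
    assume st: "s \<ge> 0 \<and> t = 0"
    then have v: "v = 0" using im d by auto
    moreover have "u\<^sup>2 \<ge> 0" by simp
    ultimately have "u\<^sup>2 = 0" using re au st by (simp only: power_zero_numeral) linarith
    then show False using v \<open>\<nu> \<noteq> 0\<close> by (simp add: u_def v_def complex_eq_iff)
  qed
qed

text \<open>Adding \<alpha> to \<nu> enlarges the positive real part and keeps the imaginary part,
  so the modulus grows.\<close>

lemma shift_quotient_Re_pos_norm_less_1:
  fixes \<nu> :: complex and \<alpha> :: real
  assumes "Re \<nu> > 0" and "\<alpha> > 0"
  shows "Re (\<nu> / (\<alpha> + \<nu>)) > 0" and "cmod (\<nu> / (\<alpha> + \<nu>)) < 1"
proof -
  have nz: "(\<alpha> + Re \<nu>)\<^sup>2 + (Im \<nu>)\<^sup>2 > 0"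
    using assms by (intro add_pos_nonneg) auto
  \<comment> \<open>This is the real part of \<nu> times the conjugate of \<alpha> + \<nu>, the
    numerator of the real part of the quotient; \<open>nz\<close> is the denominator.\<close>
  have num: "Re \<nu> * (\<alpha> + Re \<nu>) + Im \<nu> * Im \<nu> > 0"
    using assms by (intro add_pos_nonneg mult_pos_pos) auto
  show "Re (\<nu> / (\<alpha> + \<nu>)) > 0"
    using num nz by (simp add: Re_divide)
  have "(cmod \<nu>)\<^sup>2 < (cmod (\<alpha> + \<nu>))\<^sup>2"
    using assms by (simp add: cmod_power2 power_strict_mono)
  then have "cmod \<nu> < cmod (\<alpha> + \<nu>)"
    using power_less_imp_less_base norm_ge_zero by blast
  then show "cmod (\<nu> / (\<alpha> + \<nu>)) < 1"
    using norm_ge_zero[of \<nu>] by (simp add: norm_divide divide_less_eq)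
qed

section \<open>Full row rank, and complex vectors under real matrices\<close>

text \<open>A kernel vector of the transpose is orthogonal to every column. A maximal independent
  set of columns has n elements by the rank hypothesis, hence is a basis, so the vector is
  orthogonal to the whole space and in particular to the unit vectors.\<close>

lemma (in vec_space) full_row_rank_transpose_injective:
  assumes A: "A \<in> carrier_mat n nc" and rank: "rank A = n"
    and y: "y \<in> carrier_vec n" and ker: "transpose_mat A *\<^sub>v y = 0\<^sub>v nc"
  shows "y = 0\<^sub>v n"
proof -
  let ?C = "set (cols A)"
  have C: "?C \<subseteq> carrier_vec n" using A cols_dim by blast
  obtain S where S: "finite S" "maximal S (\<lambda>T. T \<subseteq> ?C \<and> lin_indpt T)"
    using maximal_exists_superset[of ?C "\<lambda>T. T \<subseteq> ?C \<and> lin_indpt T" "{}"]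
      finite_lin_indpt2[of "{}"] by auto
  then have SC: "S \<subseteq> ?C" and li: "lin_indpt S" by (auto simp: maximal_def)
  have "card S = n" using rank_card_indpt[OF A S(2)] rank by simp
  then have "basis S" using S(1) SC C li by (intro dim_li_is_basis) (auto simp: dim_is_n)
  then have span: "span S = carrier_vec n" by (simp add: basis_def)
  have "y \<bullet> c = 0" if "c \<in> ?C" for c
  proof -
    from that obtain j where j: "j < nc" "c = col A j"
      using A by (auto simp: cols_def)
    have "c \<bullet> y = (transpose_mat A *\<^sub>v y) $ j" using A j by simp
    also have "\<dots> = 0" using j ker by simp
    finally show ?thesis using that C y comm_scalar_prod by (metis subsetD)
  qed
  then have "y \<in> orthogonal_complement S"
    using y SC by (auto simp: orthogonal_complement_def)
  then have "y \<in> orthogonal_complement (carrier_vec n)"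
    using in_orthogonal_complement_span[of S] SC C span by auto
  then have "y \<bullet> unit_vec n i = 0" for i
    by (simp add: orthogonal_complement_def)
  then have "y $ i = 0" if "i < n" for i
    using scalar_prod_right_unit[OF that, of y] by simp
  then show ?thesis using y by auto
qed

lemma smult_mat_mult_vec:
  fixes Q :: "'a::comm_semiring_1 mat"
  assumes "Q \<in> carrier_mat r c" and "x \<in> carrier_vec c"
  shows "(k \<cdot>\<^sub>m Q) *\<^sub>v x = k \<cdot>\<^sub>v (Q *\<^sub>v x)"
  using assms by (intro eq_vecI) auto

lemma smult_append: "c \<cdot>\<^sub>v (x @\<^sub>v y) = (c \<cdot>\<^sub>v x) @\<^sub>v (c \<cdot>\<^sub>v y)"
  by (intro eq_vecI) auto

lemma map_vec_cmat_mult: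
  assumes "Q \<in> carrier_mat r c" and "x \<in> carrier_vec c"
  shows "map_vec Re (cmat Q *\<^sub>v x) = Q *\<^sub>v map_vec Re x"
    and "map_vec Im (cmat Q *\<^sub>v x) = Q *\<^sub>v map_vec Im x"
  using assms by (auto simp: scalar_prod_def)

lemma vec_complex_eq_0_iff:
  "x = 0\<^sub>v n \<longleftrightarrow> map_vec Re x = 0\<^sub>v n \<and> map_vec Im x = 0\<^sub>v n"
  by (auto simp: vec_eq_iff complex_eq_iff)

text \<open>Splitting into real and imaginary parts lets facts about real matrices be applied to
  complex vectors.\<close>

lemma conjugate_scalar_prod_complex:
  fixes x w :: "complex vec"
  assumes "x \<in> carrier_vec n" "w \<in> carrier_vec n"
  shows "conjugate x \<bullet> w = Complex (map_vec Re x \<bullet> map_vec Re w + map_vec Im x \<bullet> map_vec Im w)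
    (map_vec Re x \<bullet> map_vec Im w - map_vec Im x \<bullet> map_vec Re w)"
  using assms
  by (auto simp: scalar_prod_def complex_eq_iff sum.distrib sum_subtractf intro!: sum.cong)

lemma qform_cmat:
  assumes "Q \<in> carrier_mat n n" and "x \<in> carrier_vec n"
  shows "qform (cmat Q) x = Complex
    (map_vec Re x \<bullet> (Q *\<^sub>v map_vec Re x) + map_vec Im x \<bullet> (Q *\<^sub>v map_vec Im x))
    (map_vec Re x \<bullet> (Q *\<^sub>v map_vec Im x) - map_vec Im x \<bullet> (Q *\<^sub>v map_vec Re x))"
  unfolding qform_def
  by (subst conjugate_scalar_prod_complex[of x n]) (use assms in \<open>simp_all add: map_vec_cmat_mult[OF assms]\<close>)

lemma conjugate_scalar_prod_transpose:
  assumes B: "B \<in> carrier_mat m n" and x: "x \<in> carrier_vec n" and y: "y \<in> carrier_vec m"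
  shows "conjugate x \<bullet> (cmat (transpose_mat B) *\<^sub>v y) = conjugate (cmat B *\<^sub>v x) \<bullet> y"
proof -
  have BT: "transpose_mat B \<in> carrier_mat n m" using B by simp
  have adj: "u \<bullet> (transpose_mat B *\<^sub>v v) = (B *\<^sub>v u) \<bullet> v"
    if "u \<in> carrier_vec n" "v \<in> carrier_vec m" for u v
    using transpose_vec_mult_scalar[OF BT that(2,1)] by simp
  have "cmat (transpose_mat B) *\<^sub>v y \<in> carrier_vec n" "cmat B *\<^sub>v x \<in> carrier_vec m"
    using B x y by (auto intro!: mult_mat_vec_carrier)
  then show ?thesis
    using x y
    by (simp add: conjugate_scalar_prod_complex[of _ n] conjugate_scalar_prod_complex[of _ m]
        map_vec_cmat_mult[OF BT y] map_vec_cmat_mult[OF B x] adj)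
qed

text \<open>By symmetry the two mixed terms of the imaginary part are equal and cancel.\<close>

lemma qform_cmat_symmetric:
  assumes Q: "Q \<in> carrier_mat n n" and sym: "transpose_mat Q = Q" and x: "x \<in> carrier_vec n"
  shows "qform (cmat Q) x = complex_of_real
    (map_vec Re x \<bullet> (Q *\<^sub>v map_vec Re x) + map_vec Im x \<bullet> (Q *\<^sub>v map_vec Im x))"
proof -
  have "map_vec Im x \<bullet> (Q *\<^sub>v map_vec Re x) = (Q *\<^sub>v map_vec Im x) \<bullet> map_vec Re x"
    using transpose_vec_mult_scalar[OF Q, of "map_vec Re x" "map_vec Im x"] x sym by simp
  also have "\<dots> = map_vec Re x \<bullet> (Q *\<^sub>v map_vec Im x)"
    using Q x by (intro comm_scalar_prod[of _ n]) auto
  finally show ?thesis unfolding qform_cmat[OF Q x] by (simp add: complex_eq_iff)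
qed

text \<open>The form is the sum of the real forms at the real and the imaginary part of x. Both are
  nonnegative, and one is positive because x has a nonzero part.\<close>

lemma qform_pos_def:
  assumes A: "A \<in> carrier_mat n n" and spd: "symmetric_pos_def A"
    and x: "x \<in> carrier_vec n" "x \<noteq> 0\<^sub>v n"
  shows "qform (cmat A) x = a_form A x" and "a_form A x > 0"
proof -
  have sym: "transpose_mat A = A"
    and pos: "\<And>u. u \<in> carrier_vec n \<Longrightarrow> u \<noteq> 0\<^sub>v n \<Longrightarrow> u \<bullet> (A *\<^sub>v u) > 0"
    using spd A by (auto simp: symmetric_pos_def_def)
  have nonneg: "u \<bullet> (A *\<^sub>v u) \<ge> 0" if "u \<in> carrier_vec n" for u
    using pos[OF that] A by (cases "u = 0\<^sub>v n") auto
  show "qform (cmat A) x = a_form A x"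
    unfolding a_form_def qform_cmat_symmetric[OF A sym x(1)] by simp
  have R: "map_vec Re x \<in> carrier_vec n" and I: "map_vec Im x \<in> carrier_vec n" using x by auto
  show "a_form A x > 0"
    using nonneg[OF R] nonneg[OF I] pos[OF R] pos[OF I] x(2) vec_complex_eq_0_iff[of x n]
    unfolding a_form_def qform_cmat_symmetric[OF A sym x(1)] by fastforce
qed

text \<open>The product is k times a Gram matrix, thus symmetric, and its form at a real vector u is
  k times the squared norm of Bu. Only a weak inequality can be had for s, since x may lie in the
  kernel of B.\<close>

lemma s_t_form_proportional:
  assumes B: "B \<in> carrier_mat m n" and "k \<ge> 0" and x: "x \<in> carrier_vec n"
  shows "s_form B (k \<cdot>\<^sub>m B) x \<ge> 0" and "t_form B (k \<cdot>\<^sub>m B) x = 0"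
proof -
  let ?Q = "transpose_mat B * (k \<cdot>\<^sub>m B)"
  have Q: "?Q \<in> carrier_mat n n" using B by auto
  have "?Q = k \<cdot>\<^sub>m (transpose_mat B * B)"
    using B by (intro mult_smult_distrib) auto
  moreover have "transpose_mat (transpose_mat B * B) = transpose_mat B * B"
    using B by (simp add: transpose_mult[of _ n m _ n])
  moreover have "transpose_mat (k \<cdot>\<^sub>m X) = k \<cdot>\<^sub>m transpose_mat X" for X :: "real mat"
    by auto
  ultimately have sym: "transpose_mat ?Q = ?Q" by simp
  have "u \<bullet> (?Q *\<^sub>v u) \<ge> 0" if u: "u \<in> carrier_vec n" for u
  proof -
    have "?Q *\<^sub>v u = transpose_mat B *\<^sub>v (k \<cdot>\<^sub>v (B *\<^sub>v u))"
      using B u by (subst assoc_mult_mat_vec[of _ n m _ n]) (auto simp: smult_mat_mult_vec)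
    then have "u \<bullet> (?Q *\<^sub>v u) = (transpose_mat B *\<^sub>v (k \<cdot>\<^sub>v (B *\<^sub>v u))) \<bullet> u"
      using B u comm_scalar_prod[of u n "?Q *\<^sub>v u"] by simp
    also have "\<dots> = (k \<cdot>\<^sub>v (B *\<^sub>v u)) \<bullet> (B *\<^sub>v u)"
      using B u by (intro transpose_vec_mult_scalar) auto
    also have "\<dots> = k * ((B *\<^sub>v u) \<bullet> (B *\<^sub>v u))"
      using B u by simp
    also have "\<dots> \<ge> 0"
      using \<open>k \<ge> 0\<close> by (intro mult_nonneg_nonneg) (simp_all add: scalar_prod_def sum_nonneg)
    finally show ?thesis .
  qed
  then show "s_form B (k \<cdot>\<^sub>m B) x \<ge> 0" and "t_form B (k \<cdot>\<^sub>m B) x = 0"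
    unfolding s_form_def t_form_def qform_cmat_symmetric[OF Q sym x] using x by auto
qed

section \<open>Euclidean norm and matrix inverse\<close>

lemma vec_norm2_eq_0_iff:
  "x \<in> carrier_vec n \<Longrightarrow> vec_norm2 x = 0 \<longleftrightarrow> x = 0\<^sub>v n"
  by (auto simp: vec_norm2_def L2_set_eq_0_iff vec_eq_iff)

lemma vec_norm2_smult: "vec_norm2 (c \<cdot>\<^sub>v x) = cmod c * vec_norm2 x"
  by (simp add: vec_norm2_def norm_mult L2_set_right_distrib cong: L2_set_cong_simp)

lemma conjugate_scalar_prod_self: "conjugate x \<bullet> x = complex_of_real ((vec_norm2 x)\<^sup>2)"
  by (simp add: vec_norm2_def L2_set_def scalar_prod_def sum_nonneg complex_norm_square
      atLeast0LessThan mult.commute del: of_real_power)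

text \<open>Invertibility excludes the outcome \<open>None\<close> of \<open>mat_inverse\<close>, so
  \<open>the\<close> in the definition of \<open>mat_inv\<close> picks a genuine inverse.\<close>

lemma mat_inv_mult:
  assumes P: "P \<in> carrier_mat n n" and "invertible_mat P"
  shows "mat_inv P \<in> carrier_mat n n" and "mat_inv P * P = 1\<^sub>m n"
proof -
  obtain R where "P * R = 1\<^sub>m n" "R * P = 1\<^sub>m (dim_row R)"
    using assms by (auto simp: invertible_mat_def inverts_mat_def)
  \<comment> \<open>The dimensions of R are read off from the two products: the first fixes its
    columns, the second its rows.\<close>
  moreover from this have "R \<in> carrier_mat n n"
    using P by (metis carrier_matI index_mult_mat(3) index_one_mat(3) carrier_matD(2) index_mult_mat(2))
  ultimately have "P \<in> Units (ring_mat TYPE(real) n ())"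
    using P by (auto simp: Units_def ring_mat_def)
  then obtain Q where "mat_inverse P = Some Q"
    using mat_inverse(1)[OF P, of "()"] by (cases "mat_inverse P") auto
  then show "mat_inv P \<in> carrier_mat n n" and "mat_inv P * P = 1\<^sub>m n"
    using mat_inverse(2)[OF P] by (auto simp: mat_inv_def)
qed

section \<open>Eigenvectors of the saddle point matrix\<close>

context
  fixes n m :: nat and A B C :: "real mat"
  assumes A: "A \<in> carrier_mat n n" and B: "B \<in> carrier_mat m n" and C: "C \<in> carrier_mat m n"
begin

lemma saddle_mat_carrier: "saddle_mat A B C \<in> carrier_mat (n + m) (n + m)"
  using A B C by (auto simp: saddle_mat_def)

lemma P_SS_carrier: "P_SS \<alpha> A B C \<in> carrier_mat (n + m) (n + m)"
  using saddle_mat_carrier A C by (auto simp: P_SS_def)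

lemma eigenvector_saddle_iff:
  "eigenvector (cmat (saddle_mat A B C)) z \<nu> \<longleftrightarrow>
    z \<in> carrier_vec (n + m) \<and> z \<noteq> 0\<^sub>v (n + m) \<and> cmat (saddle_mat A B C) *\<^sub>v z = \<nu> \<cdot>\<^sub>v z"
  using saddle_mat_carrier by (simp add: eigenvector_def)

lemma saddle_eigen_blocks:
  assumes x: "x \<in> carrier_vec n" and y: "y \<in> carrier_vec m"
    and ev: "cmat (saddle_mat A B C) *\<^sub>v (x @\<^sub>v y) = \<nu> \<cdot>\<^sub>v (x @\<^sub>v y)"
  shows "cmat A *\<^sub>v x + cmat (transpose_mat B) *\<^sub>v y = \<nu> \<cdot>\<^sub>v x"
    and "cmat C *\<^sub>v x = (- \<nu>) \<cdot>\<^sub>v y"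
proof -
  have "cmat (saddle_mat A B C) =
      four_block_mat (cmat A) (cmat (transpose_mat B)) (- cmat C) (0\<^sub>m m m)"
    unfolding saddle_mat_def using A B C
    by (subst map_four_block_mat[of _ n n _ m _ m]) (auto intro!: arg_cong2[of _ _ _ _ "four_block_mat _ _"])
  then have "(cmat A *\<^sub>v x + cmat (transpose_mat B) *\<^sub>v y) @\<^sub>v (- cmat C *\<^sub>v x + 0\<^sub>m m m *\<^sub>v y)
      = (\<nu> \<cdot>\<^sub>v x) @\<^sub>v (\<nu> \<cdot>\<^sub>v y)"
    using ev A B C x y
    by (simp add: four_block_mat_mult_vec[of _ n n _ m _ m] smult_append)
  then have "cmat A *\<^sub>v x + cmat (transpose_mat B) *\<^sub>v y = \<nu> \<cdot>\<^sub>v x"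
    and lower: "- cmat C *\<^sub>v x + 0\<^sub>m m m *\<^sub>v y = \<nu> \<cdot>\<^sub>v y"
    using A B C x y by (auto simp: append_vec_eq[of _ n])
  then show "cmat A *\<^sub>v x + cmat (transpose_mat B) *\<^sub>v y = \<nu> \<cdot>\<^sub>v x" by simp
  show "cmat C *\<^sub>v x = (- \<nu>) \<cdot>\<^sub>v y"
  proof (rule eq_vecI)
    fix i assume "i < dim_vec ((- \<nu>) \<cdot>\<^sub>v y)"
    then show "(cmat C *\<^sub>v x) $ i = ((- \<nu>) \<cdot>\<^sub>v y) $ i"
      using arg_cong[OF lower, of "\<lambda>v. v $ i"] C x y by (simp add: minus_equation_iff)
  qed (use C y in auto)
qed

text \<open>No division by \<nu> occurs, so the identity also covers \<nu> = 0; it is used in that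
  way to exclude a zero eigenvalue in case (i).\<close>

lemma saddle_eigen_quadratic:
  assumes x: "x \<in> carrier_vec n" and y: "y \<in> carrier_vec m"
    and ev: "cmat (saddle_mat A B C) *\<^sub>v (x @\<^sub>v y) = \<nu> \<cdot>\<^sub>v (x @\<^sub>v y)"
    and norm: "vec_norm2 x = 1"
  shows "\<nu>\<^sup>2 - qform (cmat A) x * \<nu> + qform (cmat (transpose_mat B * C)) x = 0"
proof -
  note blocks = saddle_eigen_blocks[OF x y ev]
  let ?By = "cmat (transpose_mat B) *\<^sub>v y"
  have By: "?By \<in> carrier_vec n" and Ax: "cmat A *\<^sub>v x \<in> carrier_vec n"
    using A B x y by (auto intro!: mult_mat_vec_carrier)
  have cx: "conjugate x \<in> carrier_vec n" using x by simp
  \<comment> \<open>The second block row turns Cx into -\<nu> y, which links the form of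
    \<open>transpose_mat B * C\<close> to the coupling term of the first row.\<close>
  have "cmat (transpose_mat B * C) *\<^sub>v x = cmat (transpose_mat B) *\<^sub>v (cmat C *\<^sub>v x)"
    using B C x by (subst of_real_hom.mat_hom_mult[of _ n m _ n]) (auto intro: assoc_mult_mat_vec)
  also have "\<dots> = (- \<nu>) \<cdot>\<^sub>v ?By"
    unfolding blocks(2) using B y by (intro mult_mat_vec[of _ n m]) auto
  finally have "qform (cmat (transpose_mat B * C)) x = - \<nu> * (conjugate x \<bullet> ?By)"
    unfolding qform_def using cx By by simp
  moreover have "qform (cmat A) x + conjugate x \<bullet> ?By = \<nu>"
    using arg_cong[OF blocks(1), of "\<lambda>v. conjugate x \<bullet> v"] norm x
    by (simp add: qform_def conjugate_scalar_prod_self scalar_prod_add_distrib[OF cx Ax By])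
  then have "conjugate x \<bullet> ?By = \<nu> - qform (cmat A) x" by (simp add: eq_diff_eq add.commute)
  ultimately show ?thesis by (simp add: power2_eq_square algebra_simps)
qed

text \<open>If x were zero, the first block row would put y into the kernel of the transpose of B,
  which is trivial by full row rank. The eigenvector can therefore be rescaled so that x has norm 1,
  as \<open>S_set\<close> demands.\<close>

lemma saddle_eigenvector_normalized:
  assumes rank: "vec_space.rank m B = m"
    and ev: "eigenvector (cmat (saddle_mat A B C)) z \<nu>"
  obtains x y where "x \<in> carrier_vec n" "y \<in> carrier_vec m" "vec_norm2 x = 1"
    "eigenvector (cmat (saddle_mat A B C)) (x @\<^sub>v y) \<nu>"
proof -
  have z: "z \<in> carrier_vec (n + m)" "z \<noteq> 0\<^sub>v (n + m)"
    "cmat (saddle_mat A B C) *\<^sub>v z = \<nu> \<cdot>\<^sub>v z"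
    using ev by (auto simp: eigenvector_saddle_iff)
  define x y where "x = vec_first z n" and "y = vec_last z m"
  have x: "x \<in> carrier_vec n" and y: "y \<in> carrier_vec m" and zxy: "z = x @\<^sub>v y"
    using z(1) by (auto simp: x_def y_def)
  note blocks = saddle_eigen_blocks[OF x y z(3)[unfolded zxy]]
  have "x \<noteq> 0\<^sub>v n"
  proof
    assume x0: "x = 0\<^sub>v n"
    have "cmat (transpose_mat B) *\<^sub>v y = 0\<^sub>v n"
    proof -
      have "cmat A *\<^sub>v 0\<^sub>v n = 0\<^sub>v n" "cmat (transpose_mat B) *\<^sub>v y \<in> carrier_vec n"
        using A B y by (auto intro!: mult_mat_vec_carrier)
      moreover have "\<nu> \<cdot>\<^sub>v 0\<^sub>v n = 0\<^sub>v n" by auto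
      ultimately show ?thesis using blocks(1) unfolding x0 by simp
    qed
    moreover have "transpose_mat B \<in> carrier_mat n m" using B by simp
    \<comment> \<open>The rank of B is taken over the reals, so the real and imaginary parts of y
      are treated separately.\<close>
    ultimately have "transpose_mat B *\<^sub>v map_vec Re y = 0\<^sub>v n"
      "transpose_mat B *\<^sub>v map_vec Im y = 0\<^sub>v n"
      using y vec_complex_eq_0_iff by (metis map_vec_cmat_mult)+
    then have "y = 0\<^sub>v m"
      using vec_space.full_row_rank_transpose_injective[OF B rank] y
      by (simp add: vec_complex_eq_0_iff)
    then show False using z(2) zxy x0 by auto
  qed
  then have N: "vec_norm2 x \<noteq> 0" using x vec_norm2_eq_0_iff by blast
  define c where "c = complex_of_real (1 / vec_norm2 x)"
  have c: "c \<noteq> 0" using N by (simp add: c_def)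
  have "vec_norm2 x \<ge> 0" by (simp add: vec_norm2_def)
  then have "vec_norm2 (c \<cdot>\<^sub>v x) = 1"
    using N by (simp add: vec_norm2_smult c_def norm_divide)
  moreover have "(c \<cdot>\<^sub>v x) @\<^sub>v (c \<cdot>\<^sub>v y) = c \<cdot>\<^sub>v z" by (simp add: zxy smult_append)
  moreover have "eigenvector (cmat (saddle_mat A B C)) (c \<cdot>\<^sub>v z) \<nu>"
    using z c saddle_mat_carrier unfolding eigenvector_saddle_iff
    by (auto simp: mult_mat_vec[of _ "n + m" "n + m"] smult_smult_assoc mult.commute vec_eq_iff)
  ultimately show thesis using that[of "c \<cdot>\<^sub>v x" "c \<cdot>\<^sub>v y"] x y by simp
qed

lemma saddle_eigenvalue_Re_pos:
  assumes spd: "symmetric_pos_def A"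
    and x: "x \<in> carrier_vec n" and y: "y \<in> carrier_vec m" and norm: "vec_norm2 x = 1"
    and ev: "eigenvector (cmat (saddle_mat A B C)) (x @\<^sub>v y) \<nu>" and "\<nu> \<noteq> 0"
    and st: "s_form B C x > 0 \<and> \<bar>t_form B C x\<bar> < a_form A x * sqrt (s_form B C x)
      \<or> s_form B C x \<ge> 0 \<and> t_form B C x = 0"
  shows "Re \<nu> > 0"
proof -
  have "x \<noteq> 0\<^sub>v n" using norm x vec_norm2_eq_0_iff[OF x] by auto
  note a = qform_pos_def[OF A spd x this]
  have "cmat (saddle_mat A B C) *\<^sub>v (x @\<^sub>v y) = \<nu> \<cdot>\<^sub>v (x @\<^sub>v y)"
    using ev by (simp add: eigenvector_saddle_iff)
  from saddle_eigen_quadratic[OF x y this norm]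
  have "\<nu>\<^sup>2 - a_form A x * \<nu> + Complex (s_form B C x) (t_form B C x) = 0"
    by (simp add: a(1) s_form_def t_form_def)
  then show ?thesis using \<open>\<nu> \<noteq> 0\<close> a(2) st by (rule complex_quadratic_root_Re_pos)
qed

section \<open>The preconditioner and the matrices built from its inverse\<close>

lemma P_SS_mult_vec:
  assumes "z \<in> carrier_vec (n + m)"
  shows "cmat (P_SS \<alpha> A B C) *\<^sub>v z = of_real \<alpha> \<cdot>\<^sub>v z + cmat (saddle_mat A B C) *\<^sub>v z"
proof -
  have "cmat (P_SS \<alpha> A B C) = of_real \<alpha> \<cdot>\<^sub>m 1\<^sub>m (n + m) + cmat (saddle_mat A B C)"
    using A C saddle_mat_carrier by (auto simp: P_SS_def)
  then show ?thesis
    using assms saddle_mat_carrier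
    by (simp add: add_mult_distrib_mat_vec[of _ "n + m" "n + m"] smult_mat_mult_vec[of _ "n + m" "n + m"])
qed

lemma mat_inv_P_SS_mult_vec:
  assumes "invertible_mat (P_SS \<alpha> A B C)" and z: "z \<in> carrier_vec (n + m)"
  shows "cmat (mat_inv (P_SS \<alpha> A B C)) *\<^sub>v (cmat (P_SS \<alpha> A B C) *\<^sub>v z) = z"
proof -
  note inv = mat_inv_mult[OF P_SS_carrier assms(1)]
  have "cmat (mat_inv (P_SS \<alpha> A B C)) * cmat (P_SS \<alpha> A B C) = 1\<^sub>m (n + m)"
    unfolding of_real_hom.mat_hom_mult[OF inv(1) P_SS_carrier, symmetric] inv(2)
    by (rule of_real_hom.mat_hom_one)
  moreover have "cmat (mat_inv (P_SS \<alpha> A B C)) \<in> carrier_mat (n + m) (n + m)"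
    "cmat (P_SS \<alpha> A B C) \<in> carrier_mat (n + m) (n + m)"
    using inv(1) P_SS_carrier by auto
  ultimately show ?thesis using z assoc_mult_mat_vec one_mult_mat_vec by metis
qed

text \<open>Write S for the saddle point matrix. Multiplying the eigenvalue equation by the
  preconditioner gives Sz = \<mu> (\<alpha> z + Sz), that is, (1 - \<mu>) Sz = \<mu> \<alpha> z. For
  \<mu> \<noteq> 1 this makes z an eigenvector of S.\<close>

lemma eigenvector_preconditioned_imp:
  assumes \<alpha>: "\<alpha> > 0" and inv: "invertible_mat (P_SS \<alpha> A B C)"
    and ev: "eigenvector (cmat (mat_inv (P_SS \<alpha> A B C) * saddle_mat A B C)) z \<mu>"
  obtains \<nu> where "eigenvector (cmat (saddle_mat A B C)) z \<nu>" and "\<mu> = \<nu> / (\<alpha> + \<nu>)"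
proof -
  let ?P = "P_SS \<alpha> A B C" and ?S = "saddle_mat A B C"
  note Pinv = mat_inv_mult[OF P_SS_carrier inv]
  note S = saddle_mat_carrier
  have PS: "mat_inv ?P * ?S \<in> carrier_mat (n + m) (n + m)" using Pinv(1) S by simp
  then have z: "z \<in> carrier_vec (n + m)" "z \<noteq> 0\<^sub>v (n + m)"
    and eq: "cmat (mat_inv ?P * ?S) *\<^sub>v z = \<mu> \<cdot>\<^sub>v z"
    using ev Pinv(1) S by (auto simp: eigenvector_def)
  \<comment> \<open>For square matrices the left inverse is also a right inverse.\<close>
  have "?P * (mat_inv ?P * ?S) = ?S"
    using mat_mult_left_right_inverse[OF Pinv(1) P_SS_carrier Pinv(2)] Pinv(1) P_SS_carrier S
    by (metis assoc_mult_mat left_mult_one_mat)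
  then have "cmat ?S *\<^sub>v z = (cmat ?P * cmat (mat_inv ?P * ?S)) *\<^sub>v z"
    unfolding of_real_hom.mat_hom_mult[OF P_SS_carrier PS, symmetric] by simp
  also have "\<dots> = \<mu> \<cdot>\<^sub>v (cmat ?P *\<^sub>v z)"
    using P_SS_carrier PS z eq
    by (simp add: assoc_mult_mat_vec[of _ "n + m" "n + m" _ "n + m"] mult_mat_vec[of _ "n + m" "n + m"])
  finally have Sz: "cmat ?S *\<^sub>v z = \<mu> \<cdot>\<^sub>v (of_real \<alpha> \<cdot>\<^sub>v z + cmat ?S *\<^sub>v z)"
    unfolding P_SS_mult_vec[OF z(1)] .
  have comp: "(1 - \<mu>) * (cmat ?S *\<^sub>v z) $ i = \<mu> * \<alpha> * z $ i" if "i < n + m" for i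
    using arg_cong[OF Sz, of "\<lambda>v. v $ i"] that z(1) S
    by (simp add: algebra_simps del: index_mult_mat_vec)
  \<comment> \<open>At a nonzero entry of z, \<mu> = 1 would give \<alpha> z = 0 there, contrary to
    \<alpha> > 0.\<close>
  obtain j where j: "j < n + m" "z $ j \<noteq> 0" using z by (metis carrier_vecD eq_vecI index_zero_vec)
  have \<mu>: "1 - \<mu> \<noteq> 0" using comp[OF j(1)] j(2) \<alpha> by auto
  \<comment> \<open>This is the solution of \<mu> = \<nu> / (\<alpha> + \<nu>) for \<nu>.\<close>
  define \<nu> where "\<nu> = \<mu> * \<alpha> / (1 - \<mu>)"
  have "cmat ?S *\<^sub>v z = \<nu> \<cdot>\<^sub>v z"
  proof (rule eq_vecI)
    fix i assume "i < dim_vec (\<nu> \<cdot>\<^sub>v z)"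
    then have i: "i < n + m" using z(1) by simp
    then have "(cmat ?S *\<^sub>v z) $ i = \<nu> * z $ i"
      using comp[OF i] \<mu> by (simp add: \<nu>_def nonzero_eq_divide_eq mult.commute)
    then show "(cmat ?S *\<^sub>v z) $ i = (\<nu> \<cdot>\<^sub>v z) $ i" using i z(1) by simp
  qed (use S z(1) in auto)
  then have "eigenvector (cmat ?S) z \<nu>" using z by (simp add: eigenvector_saddle_iff)
  moreover have "\<alpha> + \<nu> = \<alpha> / (1 - \<mu>)" using \<mu> by (simp add: \<nu>_def field_simps)
  then have "\<mu> = \<nu> / (\<alpha> + \<nu>)" using \<alpha> \<mu> by (simp add: \<nu>_def)
  ultimately show thesis by (rule that)
qed

text \<open>On z the matrices \<alpha>I + S and \<alpha>I - S, with S the saddle point matrix, act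
  as the scalars \<alpha> + \<nu> and \<alpha> - \<nu>. This places the normalized upper blocks of
  saddle point eigenvectors in \<open>S_set\<close>, where hypothesis (i) applies.\<close>

lemma eigenvector_M_SS:
  assumes inv: "invertible_mat (P_SS \<alpha> A B C)"
    and ev: "eigenvector (cmat (saddle_mat A B C)) z \<nu>"
  shows "eigenvector (cmat (M_SS \<alpha> A B C)) z ((\<alpha> - \<nu>) / (\<alpha> + \<nu>))"
proof -
  let ?P = "P_SS \<alpha> A B C" and ?S = "saddle_mat A B C"
  let ?R = "\<alpha> \<cdot>\<^sub>m 1\<^sub>m (n + m) - ?S"
  note Pinv = mat_inv_mult(1)[OF P_SS_carrier inv]
  note S = saddle_mat_carrier
  have z: "z \<in> carrier_vec (n + m)" "z \<noteq> 0\<^sub>v (n + m)" and eq: "cmat ?S *\<^sub>v z = \<nu> \<cdot>\<^sub>v z"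
    using ev by (auto simp: eigenvector_saddle_iff)
  have "cmat ?P *\<^sub>v z = (\<alpha> + \<nu>) \<cdot>\<^sub>v z"
    using P_SS_mult_vec[OF z(1)] eq by (simp add: add_smult_distrib_vec)
  then have Pz: "(\<alpha> + \<nu>) \<cdot>\<^sub>v (cmat (mat_inv ?P) *\<^sub>v z) = z"
    using mat_inv_P_SS_mult_vec[OF inv z(1)] Pinv z(1)
    by (simp add: mult_mat_vec[of _ "n + m" "n + m"])
  \<comment> \<open>If \<alpha> + \<nu> vanished, \<open>Pz\<close> would make z zero.\<close>
  then have nz: "\<alpha> + \<nu> \<noteq> 0"
    using z(2) Pinv by (auto simp: vec_eq_iff)
  then have Pinv_z: "cmat (mat_inv ?P) *\<^sub>v z = (1 / (\<alpha> + \<nu>)) \<cdot>\<^sub>v z"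
    using arg_cong[OF Pz, of "\<lambda>v. (1 / (\<alpha> + \<nu>)) \<cdot>\<^sub>v v"] by (simp add: smult_smult_assoc)
  have R: "?R \<in> carrier_mat (n + m) (n + m)" using S by (intro minus_carrier_mat)
  have "cmat ?R = of_real \<alpha> \<cdot>\<^sub>m 1\<^sub>m (n + m) - cmat ?S"
    using S by auto
  then have Rz: "cmat ?R *\<^sub>v z = (\<alpha> - \<nu>) \<cdot>\<^sub>v z"
    using z(1) S eq
    by (simp add: minus_mult_distrib_mat_vec[of _ "n + m" "n + m"] smult_mat_mult_vec[of _ "n + m" "n + m"])
      (auto simp: vec_eq_iff algebra_simps)
  have M: "M_SS \<alpha> A B C = mat_inv ?P * ?R" using A C by (simp add: M_SS_def)
  have "cmat (M_SS \<alpha> A B C) *\<^sub>v z = cmat (mat_inv ?P) *\<^sub>v (cmat ?R *\<^sub>v z)"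
    unfolding M of_real_hom.mat_hom_mult[OF Pinv R] using Pinv R z(1)
    by (intro assoc_mult_mat_vec) auto
  also have "\<dots> = (\<alpha> - \<nu>) \<cdot>\<^sub>v ((1 / (\<alpha> + \<nu>)) \<cdot>\<^sub>v z)"
    unfolding Rz Pinv_z[symmetric] using Pinv z(1) by (intro mult_mat_vec) auto
  finally show ?thesis
    using z Pinv unfolding eigenvector_def M by (simp add: smult_smult_assoc)
qed

end

section \<open>Positive stability and the modulus bound in both cases\<close>

theorem theorem3:
  fixes n m :: nat and A B C :: "real mat" and \<alpha> :: real
  assumes "m \<le> n"
    and "A \<in> carrier_mat n n" and "symmetric_pos_def A"
    and "B \<in> carrier_mat m n" and "C \<in> carrier_mat m n"
    and "vec_space.rank m B = m" and "vec_space.rank m C = m"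
    and "\<alpha> > 0"
    and "(invertible_mat (P_SS \<alpha> A B C) \<and>
            (\<forall>x \<in> S_set \<alpha> A B C.
               s_form B C x > 0 \<and> \<bar>t_form B C x\<bar> < a_form A x * sqrt (s_form B C x)))
         \<or> (\<exists>k > 0. C = k \<cdot>\<^sub>m B)"
  shows "positive_stable (cmat (mat_inv (P_SS \<alpha> A B C) * saddle_mat A B C)) \<and>
    (\<forall>\<mu>. eigenvalue (cmat (mat_inv (P_SS \<alpha> A B C) * saddle_mat A B C)) \<mu> \<longrightarrow> cmod \<mu> < 1)"
proof -
  let ?S = "cmat (saddle_mat A B C)" and ?P = "P_SS \<alpha> A B C"
  note A = assms(2) and spd = assms(3) and B = assms(4) and C = assms(5) and rankB = assms(6)
    and \<alpha> = assms(8)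
  note P = P_SS_carrier[OF A B C, of \<alpha>]
  have "invertible_mat ?P \<and> (\<forall>z \<nu>. eigenvector ?S z \<nu> \<longrightarrow> Re \<nu> > 0)"
    using assms(9)
  proof
    assume i: "invertible_mat ?P \<and> (\<forall>x \<in> S_set \<alpha> A B C.
      s_form B C x > 0 \<and> \<bar>t_form B C x\<bar> < a_form A x * sqrt (s_form B C x))"
    have "Re \<nu> > 0" if z\<nu>: "eigenvector ?S z \<nu>" for z \<nu>
    proof -
      obtain x y where x: "x \<in> carrier_vec n" and y: "y \<in> carrier_vec m" and norm: "vec_norm2 x = 1"
        and ev: "eigenvector ?S (x @\<^sub>v y) \<nu>"
        using saddle_eigenvector_normalized[OF A B C rankB z\<nu>] .
      have "x \<in> S_set \<alpha> A B C"
        using x y norm A C eigenvector_M_SS[OF A B C _ ev] i by (auto simp: S_set_def)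
      with i have st: "s_form B C x > 0" "\<bar>t_form B C x\<bar> < a_form A x * sqrt (s_form B C x)" by auto
      \<comment> \<open>For \<nu> = 0 the quadratic leaves only its constant term, so s would be
        zero.\<close>
      have "\<nu> \<noteq> 0"
      proof
        assume "\<nu> = 0"
        then have "cmat (saddle_mat A B C) *\<^sub>v (x @\<^sub>v y) = 0 \<cdot>\<^sub>v (x @\<^sub>v y)"
          using ev eigenvector_saddle_iff[OF A B C] by simp
        from saddle_eigen_quadratic[OF A B C x y this norm]
        show False using st(1) by (simp add: s_form_def)
      qed
      then show ?thesis using saddle_eigenvalue_Re_pos[OF A B C spd x y norm ev] st by blast
    qed
    then show ?thesis using i by blast
  next
    assume "\<exists>k > 0. C = k \<cdot>\<^sub>m B"
    then obtain k where k: "k > 0" and CB: "C = k \<cdot>\<^sub>m B" by blast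
    \<comment> \<open>This concerns the saddle point matrix alone, so it is available before the
      preconditioner is known to be invertible.\<close>
    have re: "Re \<nu> > 0" if z\<nu>: "eigenvector ?S z \<nu>" for z \<nu>
    proof -
      obtain x y where x: "x \<in> carrier_vec n" and y: "y \<in> carrier_vec m" and norm: "vec_norm2 x = 1"
        and ev: "eigenvector ?S (x @\<^sub>v y) \<nu>"
        using saddle_eigenvector_normalized[OF A B C rankB z\<nu>] .
      have x0: "x \<noteq> 0\<^sub>v n" using norm vec_norm2_eq_0_iff[OF x] by auto
      \<comment> \<open>Here s may vanish, so another argument is needed: \<nu> = 0 gives Cx = 0,
        hence Bx = 0 as k > 0. The coupling term in the first block row then disappears against x,
        leaving a(x) = 0, against positive definiteness.\<close>
      have "\<nu> \<noteq> 0"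
      proof
        assume "\<nu> = 0"
        then have "cmat (saddle_mat A B C) *\<^sub>v (x @\<^sub>v y) = 0 \<cdot>\<^sub>v (x @\<^sub>v y)"
          using ev eigenvector_saddle_iff[OF A B C] by simp
        note blocks = saddle_eigen_blocks[OF A B C x y this]
        have Bx: "cmat B *\<^sub>v x = 0\<^sub>v m"
        proof (rule eq_vecI)
          fix i assume "i < dim_vec (0\<^sub>v m :: complex vec)"
          then have i: "i < m" by simp
          have "cmat C = of_real k \<cdot>\<^sub>m cmat B" unfolding CB by auto
          then have "of_real k * (cmat B *\<^sub>v x) $ i = (cmat C *\<^sub>v x) $ i"
            using i B x by (simp add: smult_mat_mult_vec[of _ m n] del: index_mult_mat_vec)
          also have "\<dots> = 0" unfolding blocks(2) using i y by simp
          finally show "(cmat B *\<^sub>v x) $ i = 0\<^sub>v m $ i" using k i by simp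
        qed (use B in auto)
        have "conjugate x \<bullet> (cmat (transpose_mat B) *\<^sub>v y) = 0"
          unfolding conjugate_scalar_prod_transpose[OF B x y] Bx using y by simp
        moreover have "conjugate x \<in> carrier_vec n" "cmat A *\<^sub>v x \<in> carrier_vec n"
          "cmat (transpose_mat B) *\<^sub>v y \<in> carrier_vec n"
          using A B x y by (auto intro!: mult_mat_vec_carrier)
        ultimately have "qform (cmat A) x = 0"
          using arg_cong[OF blocks(1), of "\<lambda>v. conjugate x \<bullet> v"] x
          by (simp add: qform_def scalar_prod_add_distrib[of _ n])
        then show False using qform_pos_def[OF A spd x x0] by simp
      qed
      moreover have "s_form B C x \<ge> 0 \<and> t_form B C x = 0"
        using s_t_form_proportional[OF B _ x, of k] k CB by simp
      ultimately show ?thesis using saddle_eigenvalue_Re_pos[OF A B C spd x y norm ev] by blast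
    qed
    have "det ?P \<noteq> 0"
    proof
      assume "det ?P = 0"
      \<comment> \<open>The determinant is moved to the complex numbers because \<open>re\<close>
        speaks of complex eigenvectors.\<close>
      then have "det (cmat ?P) = 0" by simp
      then obtain z where z: "z \<in> carrier_vec (n + m)" "z \<noteq> 0\<^sub>v (n + m)"
        and Pz: "cmat ?P *\<^sub>v z = 0\<^sub>v (n + m)"
        using det_0_iff_vec_prod_zero[of "cmat ?P" "n + m"] P by auto
      have sum0: "of_real \<alpha> \<cdot>\<^sub>v z + ?S *\<^sub>v z = 0\<^sub>v (n + m)"
        using Pz unfolding P_SS_mult_vec[OF A B C z(1)] .
      have "?S *\<^sub>v z = complex_of_real (- \<alpha>) \<cdot>\<^sub>v z"
      proof (rule eq_vecI)
        fix i assume "i < dim_vec (complex_of_real (- \<alpha>) \<cdot>\<^sub>v z)"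
        then show "(?S *\<^sub>v z) $ i = (complex_of_real (- \<alpha>) \<cdot>\<^sub>v z) $ i"
          using arg_cong[OF sum0, of "\<lambda>v. v $ i"] z(1) saddle_mat_carrier[OF A B C]
          by (simp add: eq_neg_iff_add_eq_0 add.commute del: index_mult_mat_vec)
      qed (use z(1) saddle_mat_carrier[OF A B C] in auto)
      then have "eigenvector ?S z (complex_of_real (- \<alpha>))"
        using z eigenvector_saddle_iff[OF A B C] by blast
      from re[OF this] show False using \<alpha> by simp
    qed
    then obtain R where "R \<in> carrier_mat (n + m) (n + m)" "?P * R = 1\<^sub>m (n + m)" "R * ?P = 1\<^sub>m (n + m)"
      using det_non_zero_imp_unit[OF P, of "()"] by (auto simp: Units_def ring_mat_def)
    then have "invertible_mat ?P"
      using P by (auto simp: invertible_mat_def inverts_mat_def)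
    then show ?thesis using re by blast
  qed
  then have inv: "invertible_mat ?P" and re: "\<And>z \<nu>. eigenvector ?S z \<nu> \<Longrightarrow> Re \<nu> > 0" by auto
  have "Re \<mu> > 0 \<and> cmod \<mu> < 1"
    if \<mu>_ev: "eigenvalue (cmat (mat_inv ?P * saddle_mat A B C)) \<mu>" for \<mu>
  proof -
    obtain z where "eigenvector (cmat (mat_inv ?P * saddle_mat A B C)) z \<mu>"
      using \<mu>_ev by (auto simp: eigenvalue_def)
    then obtain \<nu> :: complex where "eigenvector ?S z \<nu>" and \<mu>: "\<mu> = \<nu> / (\<alpha> + \<nu>)"
      by (rule eigenvector_preconditioned_imp[OF A B C \<alpha> inv])
    then show ?thesis using shift_quotient_Re_pos_norm_less_1[OF re \<alpha>] by blast
  qed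
  then show ?thesis
    using mat_inv_mult(1)[OF P inv] saddle_mat_carrier[OF A B C]
    by (auto simp: positive_stable_def)
qed

end
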